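(* Let $I$ be a countable set, let $E$ be a quasi-Banach ideal space over the counting measure space $(I,2^I,m)$, and let $\mathcal X=(X_\alpha)_{\alpha\in I}$ be a family of non-trivial quasi-Banach spaces with moduli of concavity $C_\alpha$ satisfying $\sup_{\alpha\in I}C_\alpha<\infty$. Then the infinite direct sum $\mathcal E(\mathcal X)=\left(\oplus_{\alpha\in I}X_\alpha\right)_E$ is complete.
   Context: A quasi-norm on a real vector space $X$ satisfies $\|x\|=0$ iff $x=0$, $\|ax\|=|a|\|x\|$, and $\|x+y\|\le C(\|x\|+\|y\|)$ for some $C\ge1$; the smallest such $C$ is the modulus of concavity of $X$. By the Aoki--Rolewicz theorem a quasi-norm is equivalent to a $p$-norm $|||\cdot|||$ for some $0<p\le 1$, and $d(x,y)=|||x-y|||^p$ is a metric; $X$ is a quasi-Banach space if it is complete for this metric. A quasi-normed (quasi-Banach) ideal space over a measure space $(\Omega,\Sigma,\mu)$ is a linear subspace $E$ of $L^0(\Omega,\Sigma,\mu)$ (classes of real measurable functions) with a (complete) quasi-norm such that (i) if $f\in L^0$, $g\in E$, $|f|\le|g|$ a.e., then $f\in E$ and $\|f\|_E\le\|g\|_E$; (ii) there is $f\in E$ strictly positive on the whole of $\Omega$. The infinite direct sum is $\left(\oplus_{\alpha\in I}X_\alpha\right)_E=\{f=(f_\alpha)_\alpha: f_\alpha\in X_\alpha \text{ for each }\alpha,\ (\|f_\alpha\|_{X_\alpha})_\alpha\in E\}$ with quasi-norm $\|f\|=\left\|(\|f_\alpha\|_{X_\alpha})_\alpha\right\|_E$.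 *)

theory Defs
  imports "HOL-Analysis.Analysis" "HOL-Library.Function_Algebras"
begin

instantiation "fun" :: (type, real_vector) real_vector
begin

definition scaleR_fun :: "real \<Rightarrow> ('a \<Rightarrow> 'b) \<Rightarrow> 'a \<Rightarrow> 'b"
  where "scaleR_fun c f = (\<lambda>x. c *\<^sub>R f x)"

instance
  by standard (simp_all add: scaleR_fun_def fun_eq_iff scaleR_add_right scaleR_add_left)

end

text \<open>
  A real vector space with a quasi-norm is given by a linear subspace \<open>S\<close> of an arbitrary
  ambient real vector space together with a function \<open>N\<close>, of which only the values on \<open>S\<close>
  matter. This allows families of different spaces: every family of real vector spaces can be
  realised by subspaces of one ambient space, for example of its algebraic direct sum.
\<close>

definition quasi_triangle :: "'a::real_vector set \<Rightarrow> ('a \<Rightarrow> real) \<Rightarrow> real \<Rightarrow> bool" where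
  "quasi_triangle S N C \<longleftrightarrow> 1 \<le> C \<and> (\<forall>x\<in>S. \<forall>y\<in>S. N (x + y) \<le> C * (N x + N y))"

definition quasi_norm_on :: "'a::real_vector set \<Rightarrow> ('a \<Rightarrow> real) \<Rightarrow> bool" where
  "quasi_norm_on S N \<longleftrightarrow>
     subspace S \<and>
     (\<forall>x\<in>S. 0 \<le> N x) \<and>
     (\<forall>x\<in>S. N x = 0 \<longleftrightarrow> x = 0) \<and>
     (\<forall>a. \<forall>x\<in>S. N (a *\<^sub>R x) = \<bar>a\<bar> * N x) \<and>
     (\<exists>C. quasi_triangle S N C)"

definition modulus_of_concavity :: "'a::real_vector set \<Rightarrow> ('a \<Rightarrow> real) \<Rightarrow> real" where
  "modulus_of_concavity S N = (LEAST C. quasi_triangle S N C)"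

definition p_norm_on :: "'a::real_vector set \<Rightarrow> real \<Rightarrow> ('a \<Rightarrow> real) \<Rightarrow> bool" where
  "p_norm_on S p P \<longleftrightarrow>
     subspace S \<and>
     (\<forall>x\<in>S. 0 \<le> P x) \<and>
     (\<forall>x\<in>S. P x = 0 \<longleftrightarrow> x = 0) \<and>
     (\<forall>a. \<forall>x\<in>S. P (a *\<^sub>R x) = \<bar>a\<bar> * P x) \<and>
     (\<forall>x\<in>S. \<forall>y\<in>S. P (x + y) powr p \<le> P x powr p + P y powr p)"

definition equivalent_on :: "'a set \<Rightarrow> ('a \<Rightarrow> real) \<Rightarrow> ('a \<Rightarrow> real) \<Rightarrow> bool" where
  "equivalent_on S N P \<longleftrightarrow>
     (\<exists>a>0. \<exists>b>0. \<forall>x\<in>S. a * N x \<le> P x \<and> P x \<le> b * N x)"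

text \<open>
  The locale \<^locale>\<open>Metric_space\<close> requires nonnegativity and symmetry on the whole type,
  hence the value 0 outside \<open>S\<close>.
\<close>

definition p_dist :: "'a::real_vector set \<Rightarrow> real \<Rightarrow> ('a \<Rightarrow> real) \<Rightarrow> 'a \<Rightarrow> 'a \<Rightarrow> real" where
  "p_dist S p P x y = (if x \<in> S \<and> y \<in> S then P (x - y) powr p else 0)"

lemma Metric_space_p_dist:
  assumes "p_norm_on S p P"
  shows "Metric_space S (p_dist S p P)"
proof
  have sub: "x - y \<in> S" if "x \<in> S" "y \<in> S" for x y
    using assms that by (auto simp: p_norm_on_def subspace_diff)
  fix x y
  show "0 \<le> p_dist S p P x y"
    by (simp add: p_dist_def)
  show "p_dist S p P x y = p_dist S p P y x"
  proof (cases "x \<in> S \<and> y \<in> S")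
    case True
    then have "P ((-1) *\<^sub>R (x - y)) = \<bar>-1\<bar> * P (x - y)"
      using assms sub[of x y] unfolding p_norm_on_def by blast
    then have "P (y - x) = P (x - y)"
      by simp
    then show ?thesis
      using True by (simp only: p_dist_def)
  qed (auto simp: p_dist_def)
  show "p_dist S p P x y = 0 \<longleftrightarrow> x = y" if "x \<in> S" "y \<in> S"
    using assms sub[OF that] that by (auto simp: p_dist_def p_norm_on_def)
  fix z
  assume S: "x \<in> S" "y \<in> S" "z \<in> S"
  then have "P ((x - y) + (y - z)) powr p \<le> P (x - y) powr p + P (y - z) powr p"
    using assms sub[OF S(1,2)] sub[OF S(2,3)] unfolding p_norm_on_def by blast
  then have "P (x - z) powr p \<le> P (x - y) powr p + P (y - z) powr p"
    by simp
  then show "p_dist S p P x z \<le> p_dist S p P x y + p_dist S p P y z"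
    using S by (simp only: p_dist_def simp_thms if_True)
qed

text \<open>
  All equivalent \<open>p\<close>-norms, for all exponents, have the same Cauchy and convergent sequences,
  so the choice of \<open>p\<close> and \<open>P\<close> is immaterial.
\<close>

definition quasi_complete_on :: "'a::real_vector set \<Rightarrow> ('a \<Rightarrow> real) \<Rightarrow> bool" where
  "quasi_complete_on S N \<longleftrightarrow>
     (\<exists>p P. 0 < p \<and> p \<le> 1 \<and> p_norm_on S p P \<and> equivalent_on S N P \<and>
        Metric_space.mcomplete S (p_dist S p P))"

definition quasi_banach_space :: "'a::real_vector set \<Rightarrow> ('a \<Rightarrow> real) \<Rightarrow> bool" where
  "quasi_banach_space S N \<longleftrightarrow> quasi_norm_on S N \<and> quasi_complete_on S N"

text \<open>
  The empty set is the only null set of the counting measure on \<open>I\<close>, so the elements of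
  \<open>L\<^sup>0\<close> are functions on \<open>I\<close> rather than proper equivalence classes. A function on \<open>I\<close> is
  represented by its extension by 0 to the whole type.
\<close>

definition L0 :: "'i set \<Rightarrow> ('i \<Rightarrow> real) set" where
  "L0 I = {f \<in> borel_measurable (count_space I). \<forall>i. i \<notin> I \<longrightarrow> f i = 0}"

definition ideal_space :: "'i set \<Rightarrow> ('i \<Rightarrow> real) set \<Rightarrow> (('i \<Rightarrow> real) \<Rightarrow> real) \<Rightarrow> bool" where
  "ideal_space I E N \<longleftrightarrow>
     E \<subseteq> L0 I \<and>
     (\<forall>f\<in>L0 I. \<forall>g\<in>E. (AE i in count_space I. \<bar>f i\<bar> \<le> \<bar>g i\<bar>) \<longrightarrow> f \<in> E \<and> N f \<le> N g) \<and>
     (\<exists>f\<in>E. \<forall>i\<in>I. 0 < f i)"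

definition quasi_banach_ideal_space ::
    "'i set \<Rightarrow> ('i \<Rightarrow> real) set \<Rightarrow> (('i \<Rightarrow> real) \<Rightarrow> real) \<Rightarrow> bool" where
  "quasi_banach_ideal_space I E N \<longleftrightarrow> quasi_banach_space E N \<and> ideal_space I E N"

definition norm_family :: "'i set \<Rightarrow> ('i \<Rightarrow> 'a \<Rightarrow> real) \<Rightarrow> ('i \<Rightarrow> 'a) \<Rightarrow> 'i \<Rightarrow> real" where
  "norm_family I N f = (\<lambda>\<alpha>. if \<alpha> \<in> I then N \<alpha> (f \<alpha>) else 0)"

text \<open>Families indexed by \<open>I\<close> are likewise extended by 0 to the whole index type.\<close>

definition direct_sum ::
    "'i set \<Rightarrow> ('i \<Rightarrow> real) set \<Rightarrow> ('i \<Rightarrow> 'a::real_vector set) \<Rightarrow> ('i \<Rightarrow> 'a \<Rightarrow> real)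
      \<Rightarrow> ('i \<Rightarrow> 'a) set" where
  "direct_sum I E X N =
     {f. (\<forall>\<alpha>\<in>I. f \<alpha> \<in> X \<alpha>) \<and> (\<forall>\<alpha>. \<alpha> \<notin> I \<longrightarrow> f \<alpha> = 0) \<and> norm_family I N f \<in> E}"

definition direct_sum_norm ::
    "'i set \<Rightarrow> (('i \<Rightarrow> real) \<Rightarrow> real) \<Rightarrow> ('i \<Rightarrow> 'a \<Rightarrow> real) \<Rightarrow> ('i \<Rightarrow> 'a) \<Rightarrow> real" where
  "direct_sum_norm I NE N f = NE (norm_family I N f)"

end

theory Submission imports Defs begin

text \<open>
  Take a Cauchy sequence in the direct sum. On each coordinate it is Cauchy, hence has a limit, and
  the only question is whether the family of these limits lies in the direct sum and is a limit in
  its quasi-norm. \<open>E\<close> need not have the Fatou property, and quasi-norms need not be continuous, so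
  one cannot pass to the limit in the norms. Instead, completeness of \<open>E\<close> supplies a majorant.
  Let \<open>D\<close> bound the moduli of concavity of \<open>E\<close> and of all \<open>X \<alpha>\<close>. After passing to a subsequence
  \<open>x\<close>, the norms of the increments \<open>x (k + 1) - x k\<close> are so small that, writing \<open>\<nu> k\<close> for the family
  of their coordinate norms, the sums \<open>s n = (\<Sum>k<n. D\<^sup>k *\<^sub>R \<nu> k)\<close> are Cauchy in \<open>E\<close>. Call their limit
  \<open>g\<close>. The weights \<open>D\<^sup>k\<close> absorb the constants that the quasi-triangle inequality produces when it is
  applied to a long sum in \<open>X \<alpha>\<close>, so that, coordinatewise, the distance from \<open>x m\<close> to the limit \<open>l\<close>
  is at most \<open>D\<^sup>2 *\<^sub>R (g - s m)\<close>. By the ideal property \<open>x m - l\<close> is in the direct sum, with norm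
  tending to 0. This is lemma \<open>seq_complete_on_direct_sum\<close>.

  Completeness of a quasi-normed space is a statement about some equivalent \<open>p\<close>-norm. Two facts
  reduce it to convergence of Cauchy sequences in the quasi-norm itself: the metric of an equivalent
  \<open>p\<close>-norm has the same Cauchy and the same convergent sequences (\<open>mcomplete_p_dist_iff\<close>), and an
  equivalent \<open>p\<close>-norm exists (\<open>Aoki_Rolewicz\<close>). The latter is needed for the direct sum, because the
  \<open>p\<close>-norms that come with the summands and with \<open>E\<close> have neither a common exponent nor common
  equivalence constants.
\<close>

section \<open>Sequential completeness\<close>

definition quasi_Cauchy_on :: "'a::real_vector set \<Rightarrow> ('a \<Rightarrow> real) \<Rightarrow> (nat \<Rightarrow> 'a) \<Rightarrow> bool" where
  "quasi_Cauchy_on S N x \<longleftrightarrow>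
     (\<forall>n. x n \<in> S) \<and> (\<forall>e>0. \<exists>M. \<forall>m\<ge>M. \<forall>n\<ge>M. N (x m - x n) < e)"

definition seq_complete_on :: "'a::real_vector set \<Rightarrow> ('a \<Rightarrow> real) \<Rightarrow> bool" where
  "seq_complete_on S N \<longleftrightarrow>
     (\<forall>x. quasi_Cauchy_on S N x \<longrightarrow> (\<exists>l\<in>S. (\<lambda>n. N (x n - l)) \<longlonglongrightarrow> 0))"

lemma mcomplete_p_dist_iff:
  assumes N: "quasi_norm_on S N" and P: "p_norm_on S p P" and p: "0 < p"
    and eq: "equivalent_on S N P"
  shows "Metric_space.mcomplete S (p_dist S p P) \<longleftrightarrow> seq_complete_on S N"
proof -
  interpret M: Metric_space S "p_dist S p P"
    by (rule Metric_space_p_dist[OF P])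
  have sub: "x - y \<in> S" if "x \<in> S" "y \<in> S" for x y
    using P that by (auto simp: p_norm_on_def subspace_diff)
  obtain a b where a: "a > 0" and b: "b > 0"
    and ab: "\<And>x. x \<in> S \<Longrightarrow> a * N x \<le> P x \<and> P x \<le> b * N x"
    using eq unfolding equivalent_on_def by blast
  have N0: "0 \<le> N x" and P0: "0 \<le> P x" if "x \<in> S" for x
    using N P that by (auto simp: quasi_norm_on_def p_norm_on_def)
  \<comment> \<open>The next two facts say that \<open>N\<close> and \<open>P powr p\<close> have the same small elements; all that
    follows compares quantifiers.\<close>
  have P_small: "P z powr p < e" if z: "z \<in> S" and e: "e > 0" and l: "N z < e powr (1/p) / b" for z e
  proof -
    have "P z < e powr (1/p)"
      using ab[OF z] l b by (simp add: field_simps)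
    then have "P z powr p < (e powr (1/p)) powr p"
      using P0[OF z] p by (intro powr_less_mono2) auto
    then show ?thesis
      using e p by (simp add: powr_powr)
  qed
  have N_small: "N z < e" if z: "z \<in> S" and e: "e > 0" and l: "P z powr p < (a * e) powr p" for z e
  proof -
    have "P z < a * e"
      using l p a e by (meson P0 z not_le powr_mono2 less_imp_le mult_nonneg_nonneg)
    then have "a * N z < a * e"
      using ab[OF z] by linarith
    then show ?thesis
      using a by simp
  qed
  have Cauchy: "M.MCauchy x \<longleftrightarrow> quasi_Cauchy_on S N x" for x
  proof
    assume x: "M.MCauchy x"
    then have xS: "x n \<in> S" for n
      by (auto simp: M.MCauchy_def)
    show "quasi_Cauchy_on S N x"
      unfolding quasi_Cauchy_on_def
    proof (intro conjI allI impI xS)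
      fix e :: real assume e: "e > 0"
      then have "(a * e) powr p > 0"
        using a by simp
      then obtain K where "\<forall>n n'. K \<le> n \<longrightarrow> K \<le> n' \<longrightarrow> p_dist S p P (x n) (x n') < (a * e) powr p"
        using x unfolding M.MCauchy_def by blast
      then show "\<exists>M. \<forall>m\<ge>M. \<forall>n\<ge>M. N (x m - x n) < e"
        using N_small[OF sub[OF xS xS] e] by (simp add: p_dist_def xS) blast
    qed
  next
    assume x: "quasi_Cauchy_on S N x"
    then have xS: "x n \<in> S" for n
      by (auto simp: quasi_Cauchy_on_def)
    show "M.MCauchy x"
      unfolding M.MCauchy_def
    proof (intro conjI allI impI)
      show "range x \<subseteq> S"
        using xS by auto
      fix e :: real assume e: "e > 0"
      then have "e powr (1/p) / b > 0"
        using b by simp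
      then obtain K where "\<forall>m\<ge>K. \<forall>n\<ge>K. N (x m - x n) < e powr (1/p) / b"
        using x unfolding quasi_Cauchy_on_def by blast
      then show "\<exists>K. \<forall>n n'. K \<le> n \<longrightarrow> K \<le> n' \<longrightarrow> p_dist S p P (x n) (x n') < e"
        using P_small[OF sub[OF xS xS] e] by (simp add: p_dist_def xS) blast
    qed
  qed
  have lim: "limitin M.mtopology x l sequentially \<longleftrightarrow> l \<in> S \<and> (\<lambda>n. N (x n - l)) \<longlonglongrightarrow> 0"
    if xS: "\<And>n. x n \<in> S" for x l
  proof (cases "l \<in> S")
    case True
    have "(\<forall>e>0. \<exists>K. \<forall>n\<ge>K. p_dist S p P (x n) l < e) \<longleftrightarrow> (\<forall>e>0. \<exists>K. \<forall>n\<ge>K. N (x n - l) < e)"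
    proof (intro iffI allI impI)
      fix e :: real assume e: "e > 0" and h: "\<forall>e>0. \<exists>K. \<forall>n\<ge>K. p_dist S p P (x n) l < e"
      then obtain K where "\<forall>n\<ge>K. p_dist S p P (x n) l < (a * e) powr p"
        using a by (metis mult_pos_pos powr_gt_zero less_numeral_extra(3))
      then show "\<exists>K. \<forall>n\<ge>K. N (x n - l) < e"
        using N_small[OF sub[OF xS True] e] by (auto simp: p_dist_def xS True)
    next
      fix e :: real assume e: "e > 0" and h: "\<forall>e>0. \<exists>K. \<forall>n\<ge>K. N (x n - l) < e"
      have "e powr (1/p) / b > 0"
        using b e by simp
      then obtain K where "\<forall>n\<ge>K. N (x n - l) < e powr (1/p) / b"
        using h by blast
      then show "\<exists>K. \<forall>n\<ge>K. p_dist S p P (x n) l < e"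
        using P_small[OF sub[OF xS True] e] by (auto simp: p_dist_def xS True)
    qed
    then show ?thesis
      using True N0[OF sub[OF xS True]] xS by (simp add: M.limit_metric_sequentially LIMSEQ_def)
  qed (simp add: M.limit_metric_sequentially)
  show ?thesis
    unfolding M.mcomplete_def seq_complete_on_def Cauchy
    using lim by (metis quasi_Cauchy_on_def)
qed

lemma quasi_norm_minus_commute:
  assumes "quasi_norm_on S N" "x \<in> S" "y \<in> S"
  shows "N (x - y) = N (y - x)"
proof -
  have "N ((-1) *\<^sub>R (x - y)) = \<bar>-1\<bar> * N (x - y)"
    using assms unfolding quasi_norm_on_def by (metis subspace_diff)
  then show ?thesis
    by simp
qed

text \<open>
  Splitting off one summand at a time costs one factor \<open>D\<close> for every summand that is still to come;
  rapid decay of the summands has to pay for the powers of \<open>D\<close>.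
\<close>

lemma quasi_norm_sum_le:
  assumes N: "quasi_norm_on S N" and D: "quasi_triangle S N D" and z: "\<And>k. z k \<in> S"
  shows "N (\<Sum>k<n. z k) \<le> (\<Sum>k<n. D ^ Suc k * N (z k))"
  using z
proof (induction n arbitrary: z)
  case 0
  have "N 0 = 0"
    using N unfolding quasi_norm_on_def by (metis subspace_0)
  then show ?case by simp
next
  case (Suc n)
  have S: "subspace S"
    using N by (simp add: quasi_norm_on_def)
  have "N (\<Sum>k<Suc n. z k) = N (z 0 + (\<Sum>k<n. z (Suc k)))"
    by (simp only: sum.lessThan_Suc_shift)
  also have "\<dots> \<le> D * (N (z 0) + N (\<Sum>k<n. z (Suc k)))"
    using D Suc.prems S unfolding quasi_triangle_def by (metis subspace_sum)
  also have "\<dots> \<le> D * (N (z 0) + (\<Sum>k<n. D ^ Suc k * N (z (Suc k))))"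
    using D Suc.IH[of "\<lambda>k. z (Suc k)"] Suc.prems
    by (intro mult_left_mono add_left_mono) (auto simp: quasi_triangle_def)
  also have "\<dots> = (\<Sum>k<Suc n. D ^ Suc k * N (z k))"
    by (simp add: sum.lessThan_Suc_shift sum_distrib_left algebra_simps del: sum.lessThan_Suc)
  finally show ?case .
qed

text \<open>
  A Cauchy sequence converges as soon as a subsequence does, and a subsequence can be chosen whose
  successive differences decay at any geometric rate given in advance.
\<close>

lemma seq_complete_onI:
  assumes N: "quasi_norm_on S N" and r: "0 < r"
    and conv: "\<And>x. (\<And>k. x k \<in> S) \<Longrightarrow> (\<And>k. N (x (Suc k) - x k) \<le> r ^ k) \<Longrightarrow>
      \<exists>l\<in>S. (\<lambda>k. N (x k - l)) \<longlonglongrightarrow> 0"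
  shows "seq_complete_on S N"
  unfolding seq_complete_on_def
proof (intro allI impI)
  fix x assume x: "quasi_Cauchy_on S N x"
  then have xS: "x n \<in> S" for n
    by (auto simp: quasi_Cauchy_on_def)
  have sub: "u - v \<in> S" if "u \<in> S" "v \<in> S" for u v
    using N that by (auto simp: quasi_norm_on_def subspace_diff)
  have N0: "0 \<le> N u" if "u \<in> S" for u
    using N that by (auto simp: quasi_norm_on_def)
  have "\<exists>M. \<forall>m\<ge>M. \<forall>n\<ge>M. N (x m - x n) < r ^ k" for k
    using x r unfolding quasi_Cauchy_on_def by (meson zero_less_power)
  then obtain M where M: "\<And>k m n. m \<ge> M k \<Longrightarrow> n \<ge> M k \<Longrightarrow> N (x m - x n) < r ^ k"
    by metis
  \<comment> \<open>A monotone sequence of indices above both \<open>M k\<close> and \<open>k\<close>.\<close>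
  define t where "t k = (\<Sum>j\<le>k. M j) + k" for k
  have tM: "M k \<le> t k" for k
    unfolding t_def by (rule trans_le_add1) (rule member_le_sum, auto)
  have tk: "k \<le> t k" and t_mono: "t k \<le> t (Suc k)" for k
    by (auto simp: t_def)
  have "N (x (t (Suc k)) - x (t k)) \<le> r ^ k" for k
    using M[of k "t (Suc k)" "t k"] tM[of k] t_mono[of k] by simp
  then obtain l where l: "l \<in> S" and lim: "(\<lambda>k. N (x (t k) - l)) \<longlonglongrightarrow> 0"
    using conv[of "\<lambda>k. x (t k)"] xS by blast
  obtain C where C: "quasi_triangle S N C"
    using N by (auto simp: quasi_norm_on_def)
  have tri: "N (u + v) \<le> C * (N u + N v)" if "u \<in> S" "v \<in> S" for u v
    using C that by (auto simp: quasi_triangle_def)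
  have C1: "1 \<le> C"
    using C by (auto simp: quasi_triangle_def)
  have "(\<lambda>n. N (x n - l)) \<longlonglongrightarrow> 0"
  proof (rule LIMSEQ_I)
    fix e :: real assume e: "e > 0"
    then have e': "e / (2 * C) > 0"
      using C1 by simp
    obtain K where K: "\<And>m n. m \<ge> K \<Longrightarrow> n \<ge> K \<Longrightarrow> N (x m - x n) < e / (2 * C)"
      using x e' unfolding quasi_Cauchy_on_def by meson
    obtain L where L: "\<And>k. k \<ge> L \<Longrightarrow> N (x (t k) - l) < e / (2 * C)"
      using LIMSEQ_D[OF lim e'] by (auto simp: N0 sub xS l)
    show "\<exists>n0. \<forall>n\<ge>n0. norm (N (x n - l) - 0) < e"
    proof (intro exI allI impI)
      fix n assume n: "n \<ge> K"
      define k where "k = max K L"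
      have "N (x n - l) \<le> C * (N (x n - x (t k)) + N (x (t k) - l))"
        using tri[of "x n - x (t k)" "x (t k) - l"] by (simp add: sub xS l)
      also have "\<dots> < C * (e / (2 * C) + e / (2 * C))"
        using K[OF n, of "t k"] L[of k] tk[of k] C1
        by (intro mult_strict_left_mono add_strict_mono) (auto simp: k_def)
      also have "\<dots> = e"
        using C1 by (simp add: field_simps)
      finally show "norm (N (x n - l) - 0) < e"
        by (simp add: N0 sub xS l)
    qed
  qed
  with l show "\<exists>l\<in>S. (\<lambda>n. N (x n - l)) \<longlonglongrightarrow> 0"
    by blast
qed

section \<open>The Aoki--Rolewicz theorem\<close>

text \<open>
  The element \<open>x\<close> is the one at which the partial sums of \<open>q\<close> first reach \<open>t\<close>.
\<close>

lemma list_split_at_mass: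
  fixes q :: "'a \<Rightarrow> real"
  assumes "xs \<noteq> []" "0 \<le> t" "t \<le> sum_list (map q xs)"
  shows "\<exists>as x bs. xs = as @ x # bs \<and> sum_list (map q as) \<le> t
           \<and> sum_list (map q bs) \<le> sum_list (map q xs) - t"
  using assms
proof (induction xs arbitrary: t)
  case (Cons y ys)
  show ?case
  proof (cases "t \<le> q y")
    case True
    then have "y # ys = [] @ y # ys \<and> sum_list (map q []) \<le> t
           \<and> sum_list (map q ys) \<le> sum_list (map q (y # ys)) - t"
      using Cons.prems by simp
    then show ?thesis by blast
  next
    case False
    then have "ys \<noteq> []"
      using Cons.prems by auto
    moreover have "0 \<le> t - q y" "t - q y \<le> sum_list (map q ys)"
      using Cons.prems False by auto
    ultimately obtain as x bs where "ys = as @ x # bs" "sum_list (map q as) \<le> t - q y"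
      "sum_list (map q bs) \<le> sum_list (map q ys) - (t - q y)"
      using Cons.IH[of "t - q y"] by blast
    then have "y # ys = (y # as) @ x # bs \<and> sum_list (map q (y # as)) \<le> t
           \<and> sum_list (map q bs) \<le> sum_list (map q (y # ys)) - t"
      by simp
    then show ?thesis by blast
  qed
qed simp

text \<open>
  Frink's metrization argument. Cut the list at half of its total mass \<open>T\<close>: both outer parts have
  mass at most \<open>T / 2\<close>, so by induction \<open>q\<close> is at most \<open>T\<close> on their sums, and the middle element
  contributes at most \<open>T\<close> trivially. The three-term hypothesis then gives \<open>2 * T\<close>, with the same
  constant for every length.
\<close>

lemma frink_inequality:
  fixes q :: "'a::real_vector \<Rightarrow> real"
  assumes S: "subspace S" and q0: "q 0 = 0" and nonneg: "\<And>x. x \<in> S \<Longrightarrow> 0 \<le> q x"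
    and three: "\<And>x y z c. x \<in> S \<Longrightarrow> y \<in> S \<Longrightarrow> z \<in> S \<Longrightarrow> q x \<le> c \<Longrightarrow> q y \<le> c \<Longrightarrow> q z \<le> c \<Longrightarrow>
      q (x + y + z) \<le> 2 * c"
    and xs: "set xs \<subseteq> S"
  shows "q (sum_list xs) \<le> 2 * sum_list (map q xs)"
  using xs
proof (induction xs rule: length_induct)
  case (1 xs)
  have sumS: "sum_list ys \<in> S" if "set ys \<subseteq> S" for ys
    using that by (induction ys) (auto simp: S subspace_0 subspace_add)
  have sum0: "0 \<le> sum_list (map q ys)" if "set ys \<subseteq> S" for ys
    using that nonneg by (intro sum_list_nonneg) auto
  show ?case
  proof (cases "xs = []")
    case True
    then show ?thesis by (simp add: q0)
  next
    case False
    define T where "T = sum_list (map q xs)"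
    have T: "0 \<le> T"
      unfolding T_def by (rule sum0) (use "1.prems" in auto)
    obtain as x bs where xs: "xs = as @ x # bs" and as: "sum_list (map q as) \<le> T / 2"
      and bs: "sum_list (map q bs) \<le> T / 2"
      using list_split_at_mass[OF False, of "T / 2" q] T by (auto simp: T_def)
    have sets: "set as \<subseteq> S" "x \<in> S" "set bs \<subseteq> S"
      using "1.prems" by (auto simp: xs)
    have "q (sum_list as) \<le> 2 * sum_list (map q as)" "q (sum_list bs) \<le> 2 * sum_list (map q bs)"
      using "1.IH" sets by (auto simp: xs)
    moreover have "q x \<le> T"
      using sum0[OF sets(1)] sum0[OF sets(3)] by (simp add: T_def xs)
    ultimately have "q (sum_list as + x + sum_list bs) \<le> 2 * T"
      using as bs sets by (intro three sumS) auto
    then show ?thesis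
      by (simp add: xs T_def add.assoc)
  qed
qed

text \<open>
  The exponent \<open>p\<close> is chosen so small that \<open>q = N powr p\<close> satisfies the three-term hypothesis of
  \<open>frink_inequality\<close>. The subadditive hull \<open>R x\<close>, the infimum of \<open>\<Sum>q x\<^sub>i\<close> over all finite
  decompositions \<open>x = \<Sum>x\<^sub>i\<close>, is at most \<open>q\<close>, and by Frink's inequality at least \<open>q / 2\<close>. Hence
  \<open>R powr (1/p)\<close> is a \<open>p\<close>-norm equivalent to \<open>N\<close>.
\<close>

theorem Aoki_Rolewicz:
  assumes N: "quasi_norm_on S N"
  shows "\<exists>p P. 0 < p \<and> p \<le> 1 \<and> p_norm_on S p P \<and> equivalent_on S N P"
proof -
  have S: "subspace S"
    using N by (simp add: quasi_norm_on_def)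
  have N0: "0 \<le> N x" and N_eq0: "N x = 0 \<longleftrightarrow> x = 0" and N_scale: "N (a *\<^sub>R x) = \<bar>a\<bar> * N x"
    if "x \<in> S" for x a
    using N that by (auto simp: quasi_norm_on_def)
  obtain C where C1: "1 \<le> C" and tri: "\<And>x y. x \<in> S \<Longrightarrow> y \<in> S \<Longrightarrow> N (x + y) \<le> C * (N x + N y)"
    using N by (auto simp: quasi_norm_on_def quasi_triangle_def)
  \<comment> \<open>\<open>3 * C\<^sup>2\<close> is the constant in \<open>N (x + y + z) \<le> 3 * C\<^sup>2 * max (N x) (max (N y) (N z))\<close>; the
    exponent turns it into 2.\<close>
  define p where "p = ln 2 / ln (3 * C\<^sup>2)"
  have C2: "3 \<le> 3 * C\<^sup>2"
    using C1 by simp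
  have "ln 2 \<le> ln (3 * C\<^sup>2)"
    using C2 by (subst ln_le_cancel_iff) auto
  then have p: "0 < p" "p \<le> 1"
    using C2 by (auto simp: p_def intro!: divide_pos_pos ln_gt_zero divide_le_eq_1_pos[THEN iffD2])
  have Cp: "(3 * C\<^sup>2) powr p = 2"
  proof -
    have "ln (3 * C\<^sup>2) > 0"
      using C2 by (intro ln_gt_zero) linarith
    moreover have "3 * C\<^sup>2 \<noteq> 0"
      using C2 by linarith
    ultimately show ?thesis
      by (simp add: p_def powr_def del: mult_eq_0_iff)
  qed
  define q where "q x = N x powr p" for x
  have q_nonneg: "0 \<le> q x" for x
    by (simp add: q_def)
  have q0: "q 0 = 0"
    using N_eq0[of 0] S by (simp add: q_def subspace_0)
  have three: "q (x + y + z) \<le> 2 * c"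
    if xyz: "x \<in> S" "y \<in> S" "z \<in> S" and c: "q x \<le> c" "q y \<le> c" "q z \<le> c" for x y z c
  proof -
    have c0: "0 \<le> c"
      using c(1) q_nonneg[of x] by linarith
    define m where "m = c powr (1/p)"
    have le_m: "N u \<le> m" if "u \<in> S" "q u \<le> c" for u
    proof -
      have "(N u powr p) powr (1/p) \<le> m"
        unfolding m_def using that p by (intro powr_mono2) (auto simp: q_def)
      then show ?thesis
        using p N0[OF that(1)] by (simp add: powr_powr)
    qed
    have m0: "0 \<le> m"
      by (simp add: m_def)
    have "N (x + y + z) \<le> C * (N (x + y) + N z)"
      using xyz S by (intro tri) (auto intro: subspace_add)
    also have "\<dots> \<le> C * (C * (N x + N y) + N z)"
      using C1 tri[OF xyz(1,2)] by (intro mult_left_mono) auto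
    also have "\<dots> \<le> C * (C * (m + m) + C * m)"
    proof -
      have "N z \<le> C * m"
        using le_m[OF xyz(3) c(3)] mult_right_mono[OF C1 m0] by simp
      then show ?thesis
        using C1 le_m[OF xyz(1) c(1)] le_m[OF xyz(2) c(2)]
        by (intro mult_left_mono add_mono) auto
    qed
    also have "\<dots> = 3 * C\<^sup>2 * m"
      by (simp add: power2_eq_square algebra_simps)
    finally have "q (x + y + z) \<le> (3 * C\<^sup>2 * m) powr p"
      unfolding q_def using p xyz S by (intro powr_mono2 N0) (auto intro: subspace_add)
    also have "\<dots> = 2 * c"
      using m0 c0 p by (subst powr_mult) (auto simp: Cp m_def powr_powr)
    finally show ?thesis .
  qed
  define dec where "dec x = {xs. set xs \<subseteq> S \<and> sum_list xs = x}" for x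
  define R where "R x = (INF xs\<in>dec x. sum_list (map q xs))" for x
  have frink: "q x / 2 \<le> sum_list (map q xs)" if "xs \<in> dec x" for x xs
    using frink_inequality[OF S q0 q_nonneg three, of xs] that by (auto simp: dec_def)
  have bdd: "bdd_below ((\<lambda>xs. sum_list (map q xs)) ` dec x)" for x
    using frink by (intro bdd_belowI2[where m = "q x / 2"])
  have R_le: "R x \<le> sum_list (map q xs)" if "xs \<in> dec x" for x xs
    unfolding R_def using bdd that by (rule cINF_lower)
  have single: "[x] \<in> dec x" if "x \<in> S" for x
    using that by (simp add: dec_def)
  have R_ge: "c \<le> R x" if "x \<in> S" "\<And>xs. xs \<in> dec x \<Longrightarrow> c \<le> sum_list (map q xs)" for x c
    unfolding R_def using single[OF that(1)] that(2) by (intro cINF_greatest) auto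
  have R_upper: "R x \<le> q x" if "x \<in> S" for x
    using R_le[OF single[OF that]] by simp
  have R_lower: "q x \<le> 2 * R x" if "x \<in> S" for x
    using R_ge[of x "q x / 2", OF that frink] by simp
  have R0: "0 \<le> R x" if "x \<in> S" for x
    using R_lower[OF that] q_nonneg[of x] by linarith
  have R_add: "R (x + y) \<le> R x + R y" if "x \<in> S" "y \<in> S" for x y
  proof -
    have "R (x + y) - sum_list (map q ys) \<le> R x" if ys: "ys \<in> dec y" for ys
    proof (rule R_ge[OF \<open>x \<in> S\<close>])
      fix xs assume "xs \<in> dec x"
      then have "xs @ ys \<in> dec (x + y)"
        using ys by (auto simp: dec_def)
      from R_le[OF this] show "R (x + y) - sum_list (map q ys) \<le> sum_list (map q xs)"
        by simp
    qed
    then have "R (x + y) - R x \<le> R y"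
      using \<open>y \<in> S\<close> by (intro R_ge) (auto simp: algebra_simps)
    then show ?thesis by simp
  qed
  have R_scale_le: "R (a *\<^sub>R x) \<le> \<bar>a\<bar> powr p * R x" if x: "x \<in> S" and a: "a \<noteq> 0" for a x
  proof -
    have "R (a *\<^sub>R x) / \<bar>a\<bar> powr p \<le> R x"
    proof (rule R_ge[OF x])
      fix xs assume xs: "xs \<in> dec x"
      have "a *\<^sub>R sum_list xs = sum_list (map ((*\<^sub>R) a) xs)"
        by (induction xs) (auto simp: scaleR_add_right)
      then have "map ((*\<^sub>R) a) xs \<in> dec (a *\<^sub>R x)"
        using xs S by (auto simp: dec_def subspace_scale)
      from R_le[OF this] have "R (a *\<^sub>R x) \<le> sum_list (map (\<lambda>u. q (a *\<^sub>R u)) xs)"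
        by (simp add: comp_def)
      also have "map (\<lambda>u. q (a *\<^sub>R u)) xs = map (\<lambda>u. \<bar>a\<bar> powr p * q u) xs"
        using xs by (intro map_cong) (auto simp: q_def dec_def N_scale N0 powr_mult)
      finally show "R (a *\<^sub>R x) / \<bar>a\<bar> powr p \<le> sum_list (map q xs)"
        using a unfolding sum_list_const_mult by (simp add: field_simps)
    qed
    then show ?thesis
      using a by (simp add: field_simps)
  qed
  \<comment> \<open>The reverse inequality is the same one for the inverse scalar.\<close>
  have R_scale: "R (a *\<^sub>R x) = \<bar>a\<bar> powr p * R x" if x: "x \<in> S" and a: "a \<noteq> 0" for a x
  proof (rule antisym[OF R_scale_le[OF x a]])
    have "R (inverse a *\<^sub>R (a *\<^sub>R x)) \<le> \<bar>inverse a\<bar> powr p * R (a *\<^sub>R x)"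
      using x a S by (intro R_scale_le) (auto simp: subspace_scale)
    also have "\<bar>inverse a\<bar> powr p = inverse (\<bar>a\<bar> powr p)"
      by (simp add: abs_inverse inverse_powr)
    finally have "R x \<le> R (a *\<^sub>R x) / \<bar>a\<bar> powr p"
      using a by (simp add: divide_inverse_commute)
    then show "\<bar>a\<bar> powr p * R x \<le> R (a *\<^sub>R x)"
      using a by (simp add: pos_le_divide_eq mult.commute)
  qed
  define P where "P x = R x powr (1/p)" for x
  have Pp: "P x powr p = R x" if "x \<in> S" for x
    using R0[OF that] p by (simp add: P_def powr_powr)
  have P_le: "P x \<le> N x" if "x \<in> S" for x
  proof -
    have "P x \<le> q x powr (1/p)"
      unfolding P_def using p R_upper[OF that] R0[OF that] by (intro powr_mono2) auto
    then show ?thesis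
      using p N0[OF that] by (simp add: q_def powr_powr)
  qed
  have N_le: "N x \<le> 2 powr (1/p) * P x" if "x \<in> S" for x
  proof -
    have "q x powr (1/p) \<le> (2 * R x) powr (1/p)"
      using p R_lower[OF that] q_nonneg by (intro powr_mono2) auto
    then show ?thesis
      using p N0[OF that] R0[OF that] by (simp add: q_def P_def powr_powr powr_mult)
  qed
  have P_nonneg: "0 \<le> P x" for x
    by (simp add: P_def)
  have P_eq0: "P x = 0 \<longleftrightarrow> x = 0" if "x \<in> S" for x
    using P_le[OF that] N_le[OF that] N_eq0[OF that] N0[OF that] P_nonneg[of x]
    by (metis antisym mult_zero_right)
  have P_scale: "P (a *\<^sub>R x) = \<bar>a\<bar> * P x" if x: "x \<in> S" for a x
  proof (cases "a = 0")
    case True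
    then show ?thesis
      using P_eq0[of 0] S by (simp add: subspace_0)
  next
    case False
    then show ?thesis
      using p R0[OF x] by (simp add: P_def R_scale[OF x] powr_mult powr_powr)
  qed
  have "p_norm_on S p P"
    unfolding p_norm_on_def
    using S P_nonneg P_eq0 P_scale R_add by (auto simp: Pp subspace_add)
  moreover have "equivalent_on S N P"
    unfolding equivalent_on_def
  proof (intro exI conjI ballI)
    show "0 < 1 / 2 powr (1/p)" "0 < (1::real)"
      by auto
    fix x assume "x \<in> S"
    then show "1 / 2 powr (1/p) * N x \<le> P x" "P x \<le> 1 * N x"
      using P_le N_le by (auto simp: field_simps)
  qed
  ultimately show ?thesis
    using p by blast
qed

theorem quasi_banach_space_iff_seq_complete:
  "quasi_banach_space S N \<longleftrightarrow> quasi_norm_on S N \<and> seq_complete_on S N"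
  unfolding quasi_banach_space_def quasi_complete_on_def
  using mcomplete_p_dist_iff Aoki_Rolewicz by metis

section \<open>Direct sums\<close>

text \<open>
  The admissible constants form a closed set that is bounded below, so the least one exists.
\<close>

lemma quasi_triangle_modulus_of_concavity:
  assumes "quasi_norm_on S N"
  shows "quasi_triangle S N (modulus_of_concavity S N)"
proof -
  define A where "A = {C. quasi_triangle S N C}"
  have ne: "A \<noteq> {}"
    using assms by (auto simp: A_def quasi_norm_on_def)
  have bdd: "bdd_below A"
    by (rule bdd_belowI[of _ 1]) (auto simp: A_def quasi_triangle_def)
  have "A = {C. 1 \<le> C} \<inter> (\<Inter>x\<in>S. \<Inter>y\<in>S. {C. N (x + y) \<le> C * (N x + N y)})"
    by (auto simp: A_def quasi_triangle_def)
  moreover have "closed \<dots>"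
    by (intro closed_Int closed_INT ballI closed_Collect_le continuous_intros)
  ultimately have "Inf A \<in> A"
    using closed_contains_Inf[OF ne bdd] by simp
  then have "modulus_of_concavity S N = Inf A"
    unfolding modulus_of_concavity_def
    by (intro Least_equality cInf_lower bdd) (auto simp: A_def)
  with \<open>Inf A \<in> A\<close> show ?thesis
    by (simp add: A_def)
qed

lemma quasi_triangle_mono:
  assumes "quasi_norm_on S N" "quasi_triangle S N C" "C \<le> D"
  shows "quasi_triangle S N D"
  unfolding quasi_triangle_def
proof (intro conjI ballI)
  show "1 \<le> D"
    using assms by (simp add: quasi_triangle_def)
  fix x y assume xy: "x \<in> S" "y \<in> S"
  then have "N (x + y) \<le> C * (N x + N y)" "0 \<le> N x" "0 \<le> N y"
    using assms by (auto simp: quasi_triangle_def quasi_norm_on_def)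
  moreover have "C * (N x + N y) \<le> D * (N x + N y)"
    using assms(3) calculation by (intro mult_right_mono) auto
  ultimately show "N (x + y) \<le> D * (N x + N y)"
    by linarith
qed


lemma sum_fun_apply: "(\<Sum>k\<in>A. f k) x = (\<Sum>k\<in>A. f k x)"
  by (induction A rule: infinite_finite_induct) auto

lemma ideal_space_dominated:
  assumes "ideal_space I E NE" "g \<in> E" "\<And>i. i \<in> I \<Longrightarrow> \<bar>h i\<bar> \<le> \<bar>g i\<bar>" "\<And>i. i \<notin> I \<Longrightarrow> h i = 0"
  shows "h \<in> E" "NE h \<le> NE g"
proof -
  have "h \<in> L0 I"
    using assms(4) by (auto simp: L0_def)
  moreover have "AE i in count_space I. \<bar>h i\<bar> \<le> \<bar>g i\<bar>"
    using assms(3) by (simp add: AE_count_space)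
  ultimately show "h \<in> E" "NE h \<le> NE g"
    using assms(1,2) unfolding ideal_space_def by blast+
qed

text \<open>
  Convergence in \<open>E\<close> implies pointwise convergence: the unit vector at \<open>\<alpha>\<close> lies in \<open>E\<close>, being
  dominated by a multiple of a strictly positive element, and \<open>f \<alpha>\<close> times this vector is dominated
  by \<open>f\<close>.
\<close>

lemma ideal_space_coordinate_bounded:
  assumes E: "quasi_norm_on E NE" "ideal_space I E NE" and \<alpha>: "\<alpha> \<in> I"
  obtains c where "0 < c" "\<And>f. f \<in> E \<Longrightarrow> c * \<bar>f \<alpha>\<bar> \<le> NE f"
proof -
  define u where "u = (\<lambda>i. if i = \<alpha> then 1 else 0 :: real)"
  obtain w where w: "w \<in> E" "\<forall>i\<in>I. 0 < w i"
    using E by (auto simp: ideal_space_def)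
  then have w_\<alpha>: "w \<alpha> \<noteq> 0"
    using \<alpha> by force
  have "(1 / w \<alpha>) *\<^sub>R w \<in> E"
    using E w by (simp add: quasi_norm_on_def subspace_scale)
  then have u: "u \<in> E"
    by (rule ideal_space_dominated[OF E(2)])
      (use \<alpha> w_\<alpha> in \<open>auto simp: u_def scaleR_fun_def\<close>)
  have "u \<noteq> 0"
    by (auto simp: u_def fun_eq_iff)
  then have "0 < NE u"
    using E(1) u unfolding quasi_norm_on_def by (metis order_le_less)
  moreover have "NE u * \<bar>f \<alpha>\<bar> \<le> NE f" if f: "f \<in> E" for f
  proof -
    have "NE (f \<alpha> *\<^sub>R u) \<le> NE f"
      using f \<alpha> by (intro ideal_space_dominated(2)[OF E(2)]) (auto simp: u_def scaleR_fun_def)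
    then show ?thesis
      using E(1) u by (simp add: quasi_norm_on_def mult.commute)
  qed
  ultimately show ?thesis
    using that by blast
qed

text \<open>
  A single constant \<open>D\<close> serves for \<open>E\<close> and for all the summands; this is where the uniform bound on
  the moduli of concavity enters.
\<close>

locale ideal_direct_sum =
  fixes I :: "'i set" and E NE and X :: "'i \<Rightarrow> 'a::real_vector set" and N D
  assumes E_norm: "quasi_norm_on E NE" and E_ideal: "ideal_space I E NE"
    and E_triangle: "quasi_triangle E NE D"
    and X_norm: "\<And>\<alpha>. \<alpha> \<in> I \<Longrightarrow> quasi_norm_on (X \<alpha>) (N \<alpha>)"
    and X_triangle: "\<And>\<alpha>. \<alpha> \<in> I \<Longrightarrow> quasi_triangle (X \<alpha>) (N \<alpha>) D"
begin

abbreviation "DS \<equiv> direct_sum I E X N"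
abbreviation "DN \<equiv> direct_sum_norm I NE N"

lemma D1: "1 \<le> D"
  using E_triangle by (simp add: quasi_triangle_def)

lemma E_subspace: "subspace E"
  using E_norm by (simp add: quasi_norm_on_def)

lemma E_scale: "f \<in> E \<Longrightarrow> NE (a *\<^sub>R f) = \<bar>a\<bar> * NE f"
  using E_norm by (simp add: quasi_norm_on_def)

lemma X_subspace: "\<alpha> \<in> I \<Longrightarrow> subspace (X \<alpha>)"
  using X_norm by (simp add: quasi_norm_on_def)

lemma X_nonneg: "\<alpha> \<in> I \<Longrightarrow> x \<in> X \<alpha> \<Longrightarrow> 0 \<le> N \<alpha> x"
  using X_norm by (simp add: quasi_norm_on_def)

lemma X_add_le: "\<alpha> \<in> I \<Longrightarrow> x \<in> X \<alpha> \<Longrightarrow> y \<in> X \<alpha> \<Longrightarrow> N \<alpha> (x + y) \<le> D * (N \<alpha> x + N \<alpha> y)"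
  using X_triangle by (simp add: quasi_triangle_def)

lemma direct_sumD:
  assumes "f \<in> DS"
  shows "\<And>\<alpha>. \<alpha> \<in> I \<Longrightarrow> f \<alpha> \<in> X \<alpha>" "\<And>\<alpha>. \<alpha> \<notin> I \<Longrightarrow> f \<alpha> = 0" "norm_family I N f \<in> E"
  using assms by (auto simp: direct_sum_def)

text \<open>
  The ideal property of \<open>E\<close>, transferred to vector-valued families. It is
  how a sum of two families, and later a limit, is seen to belong to the direct sum.
\<close>

lemma direct_sum_dominated:
  assumes "g \<in> E" "\<And>\<alpha>. \<alpha> \<in> I \<Longrightarrow> f \<alpha> \<in> X \<alpha>" "\<And>\<alpha>. \<alpha> \<notin> I \<Longrightarrow> f \<alpha> = 0"
    and le: "\<And>\<alpha>. \<alpha> \<in> I \<Longrightarrow> N \<alpha> (f \<alpha>) \<le> g \<alpha>"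
  shows "f \<in> DS" "DN f \<le> NE g"
proof -
  have *: "\<bar>norm_family I N f \<alpha>\<bar> \<le> \<bar>g \<alpha>\<bar>" if "\<alpha> \<in> I" for \<alpha>
    using le[OF that] X_nonneg[OF that assms(2)[OF that]] that by (simp add: norm_family_def)
  have "norm_family I N f \<in> E" "NE (norm_family I N f) \<le> NE g"
    using ideal_space_dominated[OF E_ideal assms(1) *] by (auto simp: norm_family_def)
  then show "f \<in> DS" "DN f \<le> NE g"
    using assms by (auto simp: direct_sum_def direct_sum_norm_def)
qed

lemma quasi_norm_on_direct_sum: "quasi_norm_on DS DN"
proof -
  \<comment> \<open>One factor \<open>D\<close> comes from the coordinates, the other from \<open>E\<close>.\<close>
  have add: "f + g \<in> DS \<and> DN (f + g) \<le> D * D * (DN f + DN g)" if f: "f \<in> DS" and g: "g \<in> DS" for f g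
  proof -
    let ?h = "norm_family I N f + norm_family I N g"
    note fD = direct_sumD[OF f] and gD = direct_sumD[OF g]
    have h: "?h \<in> E"
      using fD gD by (intro subspace_add E_subspace)
    then have "D *\<^sub>R ?h \<in> E"
      by (intro subspace_scale E_subspace)
    then have "f + g \<in> DS" "DN (f + g) \<le> NE (D *\<^sub>R ?h)"
      by (rule direct_sum_dominated;
          use fD gD in \<open>auto simp: scaleR_fun_def norm_family_def X_add_le subspace_add X_subspace\<close>)+
    moreover have "NE (D *\<^sub>R ?h) \<le> D * (D * (DN f + DN g))"
      unfolding E_scale[OF h] direct_sum_norm_def
      using D1 E_triangle fD gD by (simp add: quasi_triangle_def)
    ultimately show ?thesis
      by (simp add: mult.assoc)
  qed
  have nf_scale: "norm_family I N (a *\<^sub>R f) = \<bar>a\<bar> *\<^sub>R norm_family I N f" if "f \<in> DS" for a f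
    using direct_sumD[OF that] X_norm by (auto simp: norm_family_def scaleR_fun_def quasi_norm_on_def)
  have scale: "a *\<^sub>R f \<in> DS" if f: "f \<in> DS" for a f
    using nf_scale[OF f, of a] direct_sumD[OF f]
    by (auto simp: direct_sum_def scaleR_fun_def[of a f] subspace_scale X_subspace E_subspace)
  have "norm_family I N 0 = 0"
    using X_norm X_subspace by (auto simp: norm_family_def quasi_norm_on_def subspace_0)
  then have zero: "0 \<in> DS"
    by (auto simp: direct_sum_def subspace_0 X_subspace E_subspace)
  have DN0: "DN f = 0 \<longleftrightarrow> f = 0" if f: "f \<in> DS" for f
  proof -
    have "DN f = 0 \<longleftrightarrow> norm_family I N f = 0"
      using E_norm direct_sumD[OF f] by (simp add: quasi_norm_on_def direct_sum_norm_def)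
    also have "\<dots> \<longleftrightarrow> (\<forall>\<alpha>. norm_family I N f \<alpha> = 0)"
      by (simp add: fun_eq_iff)
    also have "\<dots> \<longleftrightarrow> (\<forall>\<alpha>. f \<alpha> = 0)"
    proof (rule all_cong1)
      show "norm_family I N f \<alpha> = 0 \<longleftrightarrow> f \<alpha> = 0" for \<alpha>
        using direct_sumD(1,2)[OF f, of \<alpha>] X_norm[of \<alpha>]
        by (cases "\<alpha> \<in> I") (simp_all add: norm_family_def quasi_norm_on_def)
    qed
    also have "\<dots> \<longleftrightarrow> f = 0"
      by (simp add: fun_eq_iff)
    finally show ?thesis .
  qed
  have "quasi_triangle DS DN (D * D)"
    using add mult_mono[OF D1 D1] D1 by (simp add: quasi_triangle_def)
  moreover have "subspace DS"
    using add scale zero by (simp add: subspace_def)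
  ultimately show ?thesis
    unfolding quasi_norm_on_def
    using DN0 E_norm direct_sumD(3) nf_scale
    by (auto simp: direct_sum_norm_def E_scale quasi_norm_on_def)
qed

text \<open>
  The rate \<open>1 / (2 * D\<^sup>2)\<close> leaves a geometric series after two losses of \<open>D\<^sup>k\<close>: one from the weights
  in the majorant, which anticipate the quasi-triangle inequality in \<open>X \<alpha>\<close>, and one from the
  quasi-triangle inequality in \<open>E\<close>.
\<close>

lemma seq_complete_on_direct_sum:
  assumes E_complete: "seq_complete_on E NE"
    and X_complete: "\<And>\<alpha>. \<alpha> \<in> I \<Longrightarrow> seq_complete_on (X \<alpha>) (N \<alpha>)"
  shows "seq_complete_on DS DN"
proof (rule seq_complete_onI[OF quasi_norm_on_direct_sum])
  show "0 < 1 / (2 * D\<^sup>2)"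
    using D1 by simp
  fix x assume xDS: "\<And>k. x k \<in> DS" and rapid: "\<And>k. DN (x (Suc k) - x k) \<le> (1 / (2 * D\<^sup>2)) ^ k"
  note xD = direct_sumD[OF xDS]
  have DS: "subspace DS"
    using quasi_norm_on_direct_sum by (simp add: quasi_norm_on_def)
  define y where "y k = x (Suc k) - x k" for k
  have yDS: "y k \<in> DS" for k
    unfolding y_def by (intro subspace_diff DS xDS)
  note yD = direct_sumD[OF yDS]
  define v where "v k = D ^ k *\<^sub>R norm_family I N (y k)" for k
  have vE: "v k \<in> E" for k
    unfolding v_def by (intro subspace_scale E_subspace yD)
  have v_apply: "v k \<alpha> = D ^ k * N \<alpha> (y k \<alpha>)" if "\<alpha> \<in> I" for k \<alpha>
    using that by (simp add: v_def scaleR_fun_def norm_family_def)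
  have v_nonneg: "0 \<le> v k \<alpha>" if "\<alpha> \<in> I" for k \<alpha>
    using v_apply[OF that] D1 X_nonneg[OF that] yD(1)[OF that] by simp
  have NE_v: "NE (v k) \<le> (1 / (2 * D)) ^ k" for k
  proof -
    have "NE (v k) \<le> D ^ k * (1 / (2 * D\<^sup>2)) ^ k"
      using rapid[of k] D1 E_scale[OF yD(3)]
      by (simp add: v_def y_def direct_sum_norm_def mult_left_mono)
    also have "\<dots> = (D * (1 / (2 * D\<^sup>2))) ^ k"
      by (rule power_mult_distrib[symmetric])
    also have "D * (1 / (2 * D\<^sup>2)) = 1 / (2 * D)"
      using D1 by (simp add: power2_eq_square)
    finally show ?thesis .
  qed
  define s where "s n = (\<Sum>k<n. v k)" for n
  have sE: "s n \<in> E" for n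
    unfolding s_def by (intro subspace_sum E_subspace vE)
  have s_diff: "s (m + n) - s m = (\<Sum>k<n. v (m + k))" for m n
  proof -
    have "s (m + n) = s m + (\<Sum>k<n. v (m + k))"
      by (induction n) (simp_all add: s_def add.assoc)
    then show ?thesis
      by simp
  qed
  have s_tail: "NE (s (m + n) - s m) \<le> 2 * D * (1 / 2) ^ m" for m n
  proof -
    have "NE (s (m + n) - s m) \<le> (\<Sum>k<n. D ^ Suc k * NE (v (m + k)))"
      unfolding s_diff by (rule quasi_norm_sum_le[OF E_norm E_triangle vE])
    also have "\<dots> \<le> (\<Sum>k<n. D ^ Suc k * (1 / (2 * D)) ^ (m + k))"
      using D1 by (intro sum_mono mult_left_mono NE_v) auto
    also have "\<dots> = (\<Sum>k<n. D * (1 / (2 * D)) ^ m * (1 / 2) ^ k)"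
    proof (rule sum.cong[OF refl])
      fix k
      have "D ^ Suc k * w ^ (m + k) = D * w ^ m * (D * w) ^ k" for w
        by (simp add: power_add power_mult_distrib)
      from this[of "1 / (2 * D)"]
      show "D ^ Suc k * (1 / (2 * D)) ^ (m + k) = D * (1 / (2 * D)) ^ m * (1 / 2) ^ k"
        using D1 by simp
    qed
    also have "\<dots> = D * (1 / (2 * D)) ^ m * (\<Sum>k<n. (1 / 2) ^ k)"
      by (rule sum_distrib_left[symmetric])
    also have "\<dots> \<le> D * (1 / 2) ^ m * 2"
    proof (intro mult_mono)
      show "(1 / (2 * D)) ^ m \<le> (1 / 2) ^ m"
        using D1 by (intro power_mono divide_left_mono) auto
      have "(\<Sum>k<n. (1 / 2) ^ k) = 2 * (1 - (1 / 2 :: real) ^ n)"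
        by (subst sum_gp_strict) simp
      also have "\<dots> \<le> 2"
        by simp
      finally show "(\<Sum>k<n. (1 / 2) ^ k) \<le> (2::real)" .
    qed (use D1 in \<open>auto intro: sum_nonneg\<close>)
    finally show ?thesis
      by simp
  qed
  have "quasi_Cauchy_on E NE s"
    unfolding quasi_Cauchy_on_def
  proof (intro conjI allI impI sE)
    fix e :: real assume "e > 0"
    then obtain M where "(1 / 2) ^ M < e / (2 * D)"
      using D1 real_arch_pow_inv[of "e / (2 * D)" "1 / 2"] by auto
    then have M: "2 * D * (1 / 2) ^ M < e"
      using D1 by (simp add: pos_less_divide_eq mult.commute)
    have *: "NE (s n - s m) < e" if "M \<le> m" "m \<le> n" for m n
    proof -
      have "NE (s n - s m) \<le> 2 * D * (1 / 2) ^ m"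
        using s_tail[of m "n - m"] that by simp
      also have "\<dots> \<le> 2 * D * (1 / 2) ^ M"
        using D1 that by (intro mult_left_mono power_decreasing) auto
      finally show ?thesis
        using M by simp
    qed
    show "\<exists>M. \<forall>m\<ge>M. \<forall>n\<ge>M. NE (s m - s n) < e"
    proof (intro exI allI impI)
      fix m n assume "M \<le> m" "M \<le> n"
      then show "NE (s m - s n) < e"
        using *[of m n] *[of n m] quasi_norm_minus_commute[OF E_norm sE sE, of m n]
        by (cases "m \<le> n") auto
    qed
  qed
  then obtain g where gE: "g \<in> E" and g_lim: "(\<lambda>n. NE (s n - g)) \<longlonglongrightarrow> 0"
    using E_complete unfolding seq_complete_on_def by blast
  have s_lim: "(\<lambda>n. s n \<alpha>) \<longlonglongrightarrow> g \<alpha>" if \<alpha>: "\<alpha> \<in> I" for \<alpha>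
  proof -
    obtain c where c: "0 < c" "\<And>f. f \<in> E \<Longrightarrow> c * \<bar>f \<alpha>\<bar> \<le> NE f"
      using ideal_space_coordinate_bounded[OF E_norm E_ideal \<alpha>] by blast
    have "\<bar>s n \<alpha> - g \<alpha>\<bar> \<le> NE (s n - g) / c" for n
    proof -
      have "c * \<bar>(s n - g) \<alpha>\<bar> \<le> NE (s n - g)"
        by (intro c(2) subspace_diff E_subspace sE gE)
      then show ?thesis
        using c(1) by (simp add: pos_le_divide_eq mult.commute)
    qed
    then have "\<forall>\<^sub>F n in sequentially. norm (s n \<alpha> - g \<alpha>) \<le> NE (s n - g) / c"
      by (intro always_eventually) simp
    moreover have "(\<lambda>n. NE (s n - g) / c) \<longlonglongrightarrow> 0"
      using g_lim by (rule tendsto_divide_zero)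
    ultimately have "(\<lambda>n. s n \<alpha> - g \<alpha>) \<longlonglongrightarrow> 0"
      by (rule Lim_null_comparison)
    then show ?thesis
      by (rule LIM_zero_cancel)
  qed
  \<comment> \<open>The partial sums increase on each coordinate, so the limit \<open>g\<close> dominates them all.\<close>
  have s_le: "s n \<alpha> \<le> g \<alpha>" if \<alpha>: "\<alpha> \<in> I" for n \<alpha>
    using v_nonneg[OF \<alpha>]
    by (intro incseq_le[OF _ s_lim[OF \<alpha>]] incseq_SucI) (simp add: s_def)
  have x_tail: "N \<alpha> (x (m + n) \<alpha> - x m \<alpha>) \<le> D * (g \<alpha> - s m \<alpha>)" if \<alpha>: "\<alpha> \<in> I" for m n \<alpha>
  proof -
    have "x (m + n) \<alpha> - x m \<alpha> = (\<Sum>k<n. y (m + k) \<alpha>)"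
      by (induction n) (simp_all add: y_def algebra_simps)
    also have "N \<alpha> \<dots> \<le> (\<Sum>k<n. D ^ Suc k * N \<alpha> (y (m + k) \<alpha>))"
      by (rule quasi_norm_sum_le[OF X_norm[OF \<alpha>] X_triangle[OF \<alpha>] yD(1)[OF \<alpha>]])
    also have "\<dots> \<le> (\<Sum>k<n. D * v (m + k) \<alpha>)"
    proof (rule sum_mono)
      fix k
      \<comment> \<open>The tail starting at \<open>m\<close> costs only \<open>D ^ k\<close>, which the weight \<open>D ^ (m + k)\<close> covers.\<close>
      have "D ^ k \<le> D ^ (m + k)"
        using D1 by (intro power_increasing) auto
      then show "D ^ Suc k * N \<alpha> (y (m + k) \<alpha>) \<le> D * v (m + k) \<alpha>"
        using D1 X_nonneg[OF \<alpha> yD(1)[OF \<alpha>]] v_apply[OF \<alpha>]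
        by (simp add: mult.assoc mult_right_mono)
    qed
    also have "\<dots> = D * (s (m + n) - s m) \<alpha>"
      by (simp add: s_diff sum_fun_apply sum_distrib_left)
    also have "\<dots> \<le> D * (g \<alpha> - s m \<alpha>)"
      using D1 s_le[OF \<alpha>] by (intro mult_left_mono) auto
    finally show ?thesis .
  qed
  have "\<exists>l\<in>X \<alpha>. (\<lambda>n. N \<alpha> (x n \<alpha> - l)) \<longlonglongrightarrow> 0" if \<alpha>: "\<alpha> \<in> I" for \<alpha>
  proof -
    have "quasi_Cauchy_on (X \<alpha>) (N \<alpha>) (\<lambda>n. x n \<alpha>)"
      unfolding quasi_Cauchy_on_def
    proof (intro conjI allI impI xD(1) \<alpha>)
      fix e :: real assume e: "e > 0"
      have "(\<lambda>m. D * (2 * (D * (g \<alpha> - s m \<alpha>)))) \<longlonglongrightarrow> D * (2 * (D * (g \<alpha> - g \<alpha>)))"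
        by (intro tendsto_intros s_lim \<alpha>)
      then have "\<forall>\<^sub>F m in sequentially. D * (2 * (D * (g \<alpha> - s m \<alpha>))) < e"
        using e by (intro order_tendstoD(2)) auto
      then obtain M where M: "D * (2 * (D * (g \<alpha> - s M \<alpha>))) < e"
        by (auto simp: eventually_sequentially)
      have near: "N \<alpha> (x m \<alpha> - x M \<alpha>) \<le> D * (g \<alpha> - s M \<alpha>)" if "M \<le> m" for m
        using x_tail[OF \<alpha>, of M "m - M"] that by simp
      show "\<exists>M. \<forall>m\<ge>M. \<forall>n\<ge>M. N \<alpha> (x m \<alpha> - x n \<alpha>) < e"
      proof (intro exI allI impI)
        fix m n assume mn: "M \<le> m" "M \<le> n"
        have "N \<alpha> (x m \<alpha> - x n \<alpha>) \<le> D * (N \<alpha> (x m \<alpha> - x M \<alpha>) + N \<alpha> (x M \<alpha> - x n \<alpha>))"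
          using X_add_le[OF \<alpha>, of "x m \<alpha> - x M \<alpha>" "x M \<alpha> - x n \<alpha>"]
          by (simp add: subspace_diff X_subspace xD(1) \<alpha>)
        also have "\<dots> \<le> D * (2 * (D * (g \<alpha> - s M \<alpha>)))"
          using D1 near[OF mn(1)] near[OF mn(2)]
            quasi_norm_minus_commute[OF X_norm[OF \<alpha>] xD(1)[OF \<alpha>] xD(1)[OF \<alpha>], of M n]
          by (intro mult_left_mono) auto
        finally show "N \<alpha> (x m \<alpha> - x n \<alpha>) < e"
          using M by simp
      qed
    qed
    then show ?thesis
      using X_complete[OF \<alpha>] unfolding seq_complete_on_def by blast
  qed
  then obtain l' where l': "\<And>\<alpha>. \<alpha> \<in> I \<Longrightarrow> l' \<alpha> \<in> X \<alpha>"
    "\<And>\<alpha>. \<alpha> \<in> I \<Longrightarrow> (\<lambda>n. N \<alpha> (x n \<alpha> - l' \<alpha>)) \<longlonglongrightarrow> 0"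
    by metis
  define l where "l \<alpha> = (if \<alpha> \<in> I then l' \<alpha> else 0)" for \<alpha>
  have lX: "l \<alpha> \<in> X \<alpha>" and l_lim: "(\<lambda>n. N \<alpha> (x n \<alpha> - l \<alpha>)) \<longlonglongrightarrow> 0" if "\<alpha> \<in> I" for \<alpha>
    using l' that by (auto simp: l_def)
  \<comment> \<open>Insert \<open>x (m + n)\<close> between \<open>x m\<close> and \<open>l\<close> and let \<open>n\<close> tend to infinity: only the distance
    from \<open>x (m + n)\<close> to \<open>l\<close> depends on \<open>n\<close> in the bound, and it tends to 0 by the choice of \<open>l\<close>.\<close>
  have pointwise: "N \<alpha> ((x m - l) \<alpha>) \<le> (D\<^sup>2 *\<^sub>R (g - s m)) \<alpha>" if \<alpha>: "\<alpha> \<in> I" for m \<alpha>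
  proof -
    have "N \<alpha> (x m \<alpha> - l \<alpha>) \<le> D * (D * (g \<alpha> - s m \<alpha>) + N \<alpha> (x (m + n) \<alpha> - l \<alpha>))" for n
    proof -
      have "N \<alpha> (x m \<alpha> - l \<alpha>) \<le> D * (N \<alpha> (x m \<alpha> - x (m + n) \<alpha>) + N \<alpha> (x (m + n) \<alpha> - l \<alpha>))"
        using X_add_le[OF \<alpha>, of "x m \<alpha> - x (m + n) \<alpha>" "x (m + n) \<alpha> - l \<alpha>"]
        by (simp add: subspace_diff X_subspace xD(1) lX \<alpha>)
      also have "N \<alpha> (x m \<alpha> - x (m + n) \<alpha>) = N \<alpha> (x (m + n) \<alpha> - x m \<alpha>)"
        by (intro quasi_norm_minus_commute[OF X_norm] xD(1) \<alpha>)
      finally show ?thesis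
        using D1 x_tail[OF \<alpha>, of m n] by (smt (verit) mult_left_mono)
    qed
    moreover have "(\<lambda>n. D * (D * (g \<alpha> - s m \<alpha>) + N \<alpha> (x (m + n) \<alpha> - l \<alpha>)))
        \<longlonglongrightarrow> D * (D * (g \<alpha> - s m \<alpha>) + 0)"
      using LIMSEQ_ignore_initial_segment[OF l_lim[OF \<alpha>], of m]
      by (intro tendsto_intros) (simp add: add.commute)
    ultimately have "N \<alpha> (x m \<alpha> - l \<alpha>) \<le> D * (D * (g \<alpha> - s m \<alpha>) + 0)"
      by (intro LIMSEQ_le_const) auto
    then show ?thesis
      by (simp add: scaleR_fun_def power2_eq_square mult.assoc)
  qed
  have gsE: "g - s m \<in> E" for m
    by (intro subspace_diff E_subspace gE sE)
  then have "D\<^sup>2 *\<^sub>R (g - s m) \<in> E" for m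
    by (intro subspace_scale E_subspace)
  note dominated = direct_sum_dominated[OF this _ _ pointwise]
  have err: "x m - l \<in> DS" "DN (x m - l) \<le> D\<^sup>2 * NE (s m - g)" for m
  proof -
    have *: "(x m - l) \<alpha> \<in> X \<alpha>" if "\<alpha> \<in> I" for \<alpha>
      using that by (simp add: subspace_diff X_subspace xD(1) lX)
    have **: "(x m - l) \<alpha> = 0" if "\<alpha> \<notin> I" for \<alpha>
      using that by (simp add: xD(2) l_def)
    show "x m - l \<in> DS"
      using dominated(1)[OF * **] .
    have "DN (x m - l) \<le> NE (D\<^sup>2 *\<^sub>R (g - s m))"
      using dominated(2)[OF * **] .
    then show "DN (x m - l) \<le> D\<^sup>2 * NE (s m - g)"
      using quasi_norm_minus_commute[OF E_norm gE sE] by (simp add: E_scale gsE)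
  qed
  \<comment> \<open>So far only the differences \<open>x m - l\<close> are known to lie in the direct sum.\<close>
  have "x 0 - (x 0 - l) \<in> DS"
    by (intro subspace_diff DS xDS err)
  then have "l \<in> DS"
    by simp
  moreover have "(\<lambda>m. DN (x m - l)) \<longlonglongrightarrow> 0"
  proof (rule Lim_null_comparison)
    show "\<forall>\<^sub>F m in sequentially. norm (DN (x m - l)) \<le> D\<^sup>2 * NE (s m - g)"
      using err quasi_norm_on_direct_sum by (simp add: quasi_norm_on_def)
    show "(\<lambda>m. D\<^sup>2 * NE (s m - g)) \<longlonglongrightarrow> 0"
      by (rule tendsto_mult_right_zero[OF g_lim])
  qed
  ultimately show "\<exists>l\<in>DS. (\<lambda>k. DN (x k - l)) \<longlonglongrightarrow> 0"
    by blast
qed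

end

theorem theorem3p1:
  fixes I :: "'i set"
    and E :: "('i \<Rightarrow> real) set"
    and NE :: "('i \<Rightarrow> real) \<Rightarrow> real"
    and X :: "'i \<Rightarrow> 'a::real_vector set"
    and N :: "'i \<Rightarrow> 'a \<Rightarrow> real"
  assumes "countable I"
    and "quasi_banach_ideal_space I E NE"
    and "\<And>\<alpha>. \<alpha> \<in> I \<Longrightarrow> quasi_banach_space (X \<alpha>) (N \<alpha>)"
    and "\<And>\<alpha>. \<alpha> \<in> I \<Longrightarrow> X \<alpha> \<noteq> {0}"
    and "bdd_above ((\<lambda>\<alpha>. modulus_of_concavity (X \<alpha>) (N \<alpha>)) ` I)"
  shows "quasi_banach_space (direct_sum I E X N) (direct_sum_norm I NE N)"
proof -
  have E: "quasi_norm_on E NE" "seq_complete_on E NE" "ideal_space I E NE"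
    using assms(2) by (auto simp: quasi_banach_ideal_space_def quasi_banach_space_iff_seq_complete)
  have X: "quasi_norm_on (X \<alpha>) (N \<alpha>)" "seq_complete_on (X \<alpha>) (N \<alpha>)" if "\<alpha> \<in> I" for \<alpha>
    using assms(3)[OF that] by (auto simp: quasi_banach_space_iff_seq_complete)
  obtain K where K: "\<And>\<alpha>. \<alpha> \<in> I \<Longrightarrow> modulus_of_concavity (X \<alpha>) (N \<alpha>) \<le> K"
    using assms(5) by (auto simp: bdd_above_def)
  define D where "D = max K (modulus_of_concavity E NE)"
  have "quasi_triangle E NE D"
    using quasi_triangle_mono[OF E(1) quasi_triangle_modulus_of_concavity[OF E(1)], of D]
    by (simp add: D_def)
  moreover have "quasi_triangle (X \<alpha>) (N \<alpha>) D" if "\<alpha> \<in> I" for \<alpha>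
    using quasi_triangle_mono[OF X(1) quasi_triangle_modulus_of_concavity[OF X(1)], OF that that, of D]
      K[OF that] by (simp add: D_def)
  ultimately interpret ideal_direct_sum I E NE X N D
    using E X by unfold_locales auto
  show ?thesis
    using quasi_norm_on_direct_sum seq_complete_on_direct_sum E X
    by (simp add: quasi_banach_space_iff_seq_complete)
qed

end
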